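(* Let $d=3k$ with $k\geq 3$ and $k\equiv 1 \pmod 2$, and let $j_1,j_2$ be positive integers such that $$\bigl(d,\{[j_1,j_2,\underbrace{2,\ldots,2}_{k}],[\underbrace{3,\ldots,3}_{k}],[\underbrace{3,\ldots,3}_{k}]\}\bigr)$$ is a candidate branching datum on the Riemann sphere. If $j_1$ and $j_2$ have different parity, then this candidate branching datum is exceptional.
   Context: The setting is rational maps $\overline{\mathbb{C}}\to\overline{\mathbb{C}}$ of the Riemann sphere $\overline{\mathbb{C}}=\mathbb{C}\cup\{\infty\}$. Square brackets denote unordered lists with repetitions (multisets). For a non-constant rational map $h$ of degree $d$ and $x\in\overline{\mathbb{C}}$, let $\mu(x)$ be the partition of $d$ formed by the local degrees (multiplicities) of $h$ at the points of $h^{-1}(x)$. The branching points of $h$ are the points $x$ for which $\mu(x)$ is not the trivial partition $[1,\ldots,1]$, and the branching datum of $h$ is the collection (with repetitions) of the partitions $\mu(x)$ over all branching points $x$. A pair $(d,\mathcal{D})$, with $d\geq 2$ an integer and $\mathcal{D}$ a finite collection (with repetitions) of nontrivial partitions of $d$ having $r_1,\ldots,r_n$ parts respectively, is a candidate branching datum (on the sphere) if it satisfies the Riemann-Hurwitz formula $\sum_{i=1}^{n}(d-r_i)=2d-2$. A candidate branching datum $(d,\mathcal{D})$ is exceptional if there is no rational map $\overline{\mathbb{C}}\to\overline{\mathbb{C}}$ of degree $d$ whose branching datum is $\mathcal{D}$. *)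

theory Defs
  imports
    "HOL-Complex_Analysis.Complex_Analysis"
    "HOL-Computational_Algebra.Computational_Algebra"
    "HOL-Library.Multiset"
begin

section \<open>The Riemann sphere and rational maps\<close>

text \<open>
  The Riemann sphere is the one-point compactification of the complex plane, with \<^term>\<open>None\<close>
  as the point at infinity (as for \<^const>\<open>Alexandroff_compactification\<close> in the library).
\<close>

type_synonym riemann_sphere = "complex option"

text \<open>
  The map \<open>p/q\<close>, intended for coprime \<open>p\<close> and \<open>q\<close>: then \<open>q(z) = 0\<close> means that \<open>z\<close> is a pole.
  With \<open>m = max (deg p) (deg q)\<close>, the value at infinity is the quotient of the coefficients of
  degree \<open>m\<close>, which do not both vanish.
\<close>

definition rat_eval :: "complex poly \<Rightarrow> complex poly \<Rightarrow> riemann_sphere \<Rightarrow> riemann_sphere" where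
  "rat_eval p q x =
     (case x of
        Some z \<Rightarrow> if poly q z = 0 then None else Some (poly p z / poly q z)
      | None \<Rightarrow> (let m = max (degree p) (degree q)
                 in if coeff q m = 0 then None else Some (coeff p m / coeff q m)))"

definition rational_map_of_degree :: "nat \<Rightarrow> (riemann_sphere \<Rightarrow> riemann_sphere) \<Rightarrow> bool" where
  "rational_map_of_degree d h \<longleftrightarrow>
     (\<exists>p q. coprime p q \<and> max (degree p) (degree q) = d \<and> h = rat_eval p q)"

section \<open>Local degrees\<close>

text \<open>
  \<open>chart x\<close> is the standard local coordinate centred at \<open>x\<close> (\<open>z - a\<close> at a finite point \<open>a\<close>,
  \<open>1/z\<close> at infinity), and \<open>chart_inv x\<close> is its local inverse.  The values of \<open>chart (Some a)\<close> at
  infinity and of \<open>chart None\<close> at \<open>Some 0\<close> lie outside the domain of the coordinate; they are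
  arbitrary and do not affect the order of vanishing below.
\<close>

fun chart :: "riemann_sphere \<Rightarrow> riemann_sphere \<Rightarrow> complex" where
  "chart (Some a) (Some z) = z - a"
| "chart (Some a) None = 0"
| "chart None (Some z) = inverse z"
| "chart None None = 0"

fun chart_inv :: "riemann_sphere \<Rightarrow> complex \<Rightarrow> riemann_sphere" where
  "chart_inv (Some a) u = Some (a + u)"
| "chart_inv None u = (if u = 0 then None else Some (inverse u))"

text \<open>
  The local degree at \<open>x\<close> is the order of the zero at \<open>0\<close> of \<open>h\<close> written in the coordinates centred
  at \<open>x\<close> and \<open>h x\<close>; for a non-constant rational map this order is a positive integer.
\<close>

definition local_degree :: "(riemann_sphere \<Rightarrow> riemann_sphere) \<Rightarrow> riemann_sphere \<Rightarrow> nat" where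
  "local_degree h x = nat (zorder (\<lambda>u. chart (h x) (h (chart_inv x u))) 0)"

section \<open>Branching data\<close>

definition partition_of :: "nat \<Rightarrow> nat multiset \<Rightarrow> bool" where
  "partition_of d \<pi> \<longleftrightarrow> 0 \<notin># \<pi> \<and> sum_mset \<pi> = d"

definition trivial_partition :: "nat \<Rightarrow> nat multiset" where
  "trivial_partition d = replicate_mset d 1"

text \<open>
  Fibres and the set of branching points are finite for a non-constant rational map, so
  \<^const>\<open>mset_set\<close> (which is empty on infinite sets) lists them in full.
\<close>

definition fibre_partition ::
    "(riemann_sphere \<Rightarrow> riemann_sphere) \<Rightarrow> riemann_sphere \<Rightarrow> nat multiset" where
  "fibre_partition h x = image_mset (local_degree h) (mset_set {y. h y = x})"

definition branching_points ::
    "nat \<Rightarrow> (riemann_sphere \<Rightarrow> riemann_sphere) \<Rightarrow> riemann_sphere set" where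
  "branching_points d h = {x. fibre_partition h x \<noteq> trivial_partition d}"

definition branching_datum ::
    "nat \<Rightarrow> (riemann_sphere \<Rightarrow> riemann_sphere) \<Rightarrow> nat multiset multiset" where
  "branching_datum d h = image_mset (fibre_partition h) (mset_set (branching_points d h))"

definition candidate_branching_datum :: "nat \<Rightarrow> nat multiset multiset \<Rightarrow> bool" where
  "candidate_branching_datum d D \<longleftrightarrow>
     d \<ge> 2 \<and>
     (\<forall>\<pi>\<in>#D. partition_of d \<pi> \<and> \<pi> \<noteq> trivial_partition d) \<and>
     (\<Sum>\<pi>\<in>#D. int d - int (size \<pi>)) = 2 * int d - 2"

definition exceptional :: "nat \<Rightarrow> nat multiset multiset \<Rightarrow> bool" where
  "exceptional d D \<longleftrightarrow>
     candidate_branching_datum d D \<and>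
     \<not> (\<exists>h. rational_map_of_degree d h \<and> branching_datum d h = D)"

end

theory Submission
  imports Defs
begin

text \<open>
  Suppose that \<open>h = p/q\<close> realizes the datum, and move the two branching points with fibre
  partition \<open>[3,\<dots>,3]\<close> to \<open>0\<close> and \<open>\<infinity>\<close>.  All zeros and poles of \<open>h\<close> are then triple, so that \<open>h\<close> is the
  cube of a rational map \<open>R\<close> of degree \<open>k\<close>, and one can scale so that the third branching point is
  \<open>1\<close>.  Its fibre is the disjoint union of the fibres of \<open>R\<close> over the three cube roots of unity, with
  the local degrees of \<open>R\<close>, because cubing is locally injective there.  The local degrees in each of
  these three fibres add up to the odd number \<open>k\<close>, so each contains an odd one, and the third partition
  has at least three odd parts.  But \<open>[j\<^sub>1, j\<^sub>2, 2,\<dots>,2]\<close> has at most two.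

  To treat the point at infinity like every other point, no coordinates are changed on the sphere.
  The fibre of \<open>p/q\<close> over \<open>v\<close> is the zero set, with multiplicities, of a form of degree \<open>d = 3k\<close> in the
  pencil spanned by \<open>p\<close> and \<open>q\<close> (lemma \<open>fibre_partition_rat_eval\<close>).  Over the two points with triple
  fibres this form is a cube (lemma \<open>fibre_form_is_cube\<close>), and any three members of the pencil are
  linearly dependent, so the form \<open>C\<close> of the third point can be written \<open>C = U\<^sup>3 - V\<^sup>3\<close> with \<open>U\<close>, \<open>V\<close>
  without common zeros.  Its three factors \<open>U - w V\<close> with \<open>w\<^sup>3 = 1\<close> have odd degree \<open>k\<close> and no common
  zeros, and each contributes a zero of odd order (lemma \<open>three_odd_orders\<close>).
\<close>

section \<open>Binary forms on the sphere\<close>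

text \<open>
  A polynomial of degree at most \<open>n\<close> stands for a binary form of degree \<open>n\<close> on the sphere.  The value
  at infinity is that of the form at \<open>(1, 0)\<close>, so it depends on \<open>n\<close>; only its vanishing is independent
  of the choice of homogeneous coordinates.
\<close>

definition form_eval :: "nat \<Rightarrow> complex poly \<Rightarrow> riemann_sphere \<Rightarrow> complex" where
  "form_eval n F x = (case x of Some z \<Rightarrow> poly F z | None \<Rightarrow> coeff F n)"

definition form_order :: "nat \<Rightarrow> complex poly \<Rightarrow> riemann_sphere \<Rightarrow> nat" where
  "form_order n F x = (case x of Some z \<Rightarrow> order z F | None \<Rightarrow> n - degree F)"

lemma form_eval_diff: "form_eval n (F - G) x = form_eval n F x - form_eval n G x"
  by (simp add: form_eval_def split: option.split)

lemma form_eval_smult: "form_eval n (smult c F) x = c * form_eval n F x"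
  by (simp add: form_eval_def split: option.split)

lemma form_order_pos_iff:
  assumes "F \<noteq> 0" "degree F \<le> n"
  shows "form_order n F x > 0 \<longleftrightarrow> form_eval n F x = 0"
proof (cases x)
  case None
  have "coeff F n = 0 \<longleftrightarrow> degree F < n"
    using assms by (metis coeff_eq_0 le_neq_implies_less leading_coeff_0_iff)
  then show ?thesis by (simp add: None form_order_def form_eval_def)
next
  case (Some z)
  then show ?thesis using assms by (simp add: form_order_def form_eval_def order_root)
qed

lemma form_order_mult:
  assumes "F * G \<noteq> 0" "degree F \<le> m" "degree G \<le> n"
  shows "form_order (m + n) (F * G) x = form_order m F x + form_order n G x"
  using assms by (cases x) (auto simp: form_order_def order_mult degree_mult_eq)

lemma finite_form_zeros:
  assumes "F \<noteq> 0"
  shows "finite {x. form_eval n F x = 0}"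
proof (rule finite_subset)
  show "{x. form_eval n F x = 0} \<subseteq> insert None (Some ` {z. poly F z = 0})"
  proof
    fix x assume "x \<in> {x. form_eval n F x = 0}"
    then show "x \<in> insert None (Some ` {z. poly F z = 0})"
      by (cases x) (auto simp: form_eval_def)
  qed
  show "finite (insert None (Some ` {z. poly F z = 0}))"
    using assms by (simp add: poly_roots_finite)
qed

text \<open>
  Dividing all exponents by \<open>m\<close> in the factorization into linear factors gives the root, up to
  a root of the leading coefficient.
\<close>

lemma complex_poly_is_power:
  fixes F :: "complex poly"
  assumes "m > 0" "\<And>z. m dvd order z F"
  obtains U where "F = U ^ m"
proof -
  obtain c where c: "lead_coeff F = c ^ m"
    using exists_complex_root[of m "lead_coeff F"] assms(1) by auto
  have "F = smult (lead_coeff F) (\<Prod>z|poly F z = 0. [:-z, 1:] ^ order z F)"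
    by (rule complex_poly_decompose [symmetric])
  also have "(\<Prod>z|poly F z = 0. [:-z, 1:] ^ order z F)
      = (\<Prod>z|poly F z = 0. [:-z, 1:] ^ (order z F div m)) ^ m"
    using assms(2) by (simp add: prod_power_distrib flip: power_mult)
  finally have "F = smult c (\<Prod>z|poly F z = 0. [:-z, 1:] ^ (order z F div m)) ^ m"
    by (simp add: c smult_power)
  then show thesis by (rule that)
qed

text \<open>
  The orders of a form of degree \<open>n\<close> add up to \<open>n\<close>, so they cannot all be even.  Instead of summing, one
  can observe that a form whose orders are all even is a square, and hence of even degree.
\<close>

lemma odd_form_has_odd_order_zero:
  assumes "F \<noteq> 0" "degree F \<le> n" "odd n"
  obtains x where "odd (form_order n F x)"
proof (rule ccontr)
  assume "\<not> thesis"
  then have ev: "even (form_order n F x)" for x using that by blast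
  then have "even (order z F)" for z
    using ev[of "Some z"] by (simp add: form_order_def)
  then obtain U where U: "F = U ^ 2" using complex_poly_is_power[of 2 F] by auto
  with assms(1) have "even (degree F)" by (auto simp: degree_power_eq)
  moreover have "even (n - degree F)" using ev[of None] by (simp add: form_order_def)
  ultimately show False using assms by auto
qed

section \<open>Fibres of a rational map as zeros of forms\<close>

text \<open>
  The value of \<open>p/q\<close> at \<open>x\<close> is the point with homogeneous coordinates \<open>[p(x) : q(x)]\<close>
  (\<open>sphere_point\<close> below), and the target point \<open>v\<close> is the zero of a linear form on the target sphere.
  \<open>fibre_form\<close> is the pull-back of that linear form, and \<open>fibre_denom\<close> that of a second one, chosen
  such that the coordinate \<open>chart v\<close> is the quotient of the two.
\<close>

definition fibre_form :: "complex poly \<Rightarrow> complex poly \<Rightarrow> riemann_sphere \<Rightarrow> complex poly" where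
  "fibre_form p q v = (case v of Some a \<Rightarrow> p - smult a q | None \<Rightarrow> q)"

definition fibre_denom :: "complex poly \<Rightarrow> complex poly \<Rightarrow> riemann_sphere \<Rightarrow> complex poly" where
  "fibre_denom p q v = (case v of Some a \<Rightarrow> q | None \<Rightarrow> p)"

definition sphere_point :: "complex \<Rightarrow> complex \<Rightarrow> riemann_sphere" where
  "sphere_point P Q = (if Q = 0 then None else Some (P / Q))"

lemma rat_eval_Some: "rat_eval p q (Some z) = sphere_point (poly p z) (poly q z)"
  by (simp add: rat_eval_def sphere_point_def)

lemma rat_eval_eq_sphere_point:
  assumes "max (degree p) (degree q) = d"
  shows "rat_eval p q x = sphere_point (form_eval d p x) (form_eval d q x)"
  using assms by (auto simp: rat_eval_def sphere_point_def form_eval_def Let_def split: option.split)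

lemma coprime_forms_no_common_zero:
  assumes "coprime p q" "max (degree p) (degree q) = d" "d > 0"
  shows "form_eval d p x \<noteq> 0 \<or> form_eval d q x \<noteq> 0"
proof (cases x)
  case None
  have "coeff p d \<noteq> 0 \<or> coeff q d \<noteq> 0"
    using assms by (metis degree_0 leading_coeff_0_iff less_irrefl max_def)
  then show ?thesis by (simp add: None form_eval_def)
next
  case (Some z)
  then show ?thesis using coprime_poly_0[OF assms(1), of z] by (simp add: form_eval_def)
qed

text \<open>
  A vanishing member of the pencil would make \<open>p\<close> and \<open>q\<close> proportional; being coprime, they would be
  constant.
\<close>

lemma fibre_form_nonzero:
  assumes "coprime p q" "max (degree p) (degree q) = d" "d > 0"
  shows "fibre_form p q v \<noteq> 0"
proof
  assume eq: "fibre_form p q v = 0"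
  have "q dvd p \<or> q = 0"
    using eq by (cases v) (auto simp: fibre_form_def dvd_smult)
  then have "degree p = 0 \<and> degree q = 0"
  proof
    assume "q dvd p"
    then have "is_unit q" using assms(1) by (meson coprime_common_divisor dvd_refl)
    then have q0: "degree q = 0" by (auto simp: is_unit_poly_iff)
    moreover have "degree p = 0"
    proof (cases v)
      case None then show ?thesis using eq \<open>is_unit q\<close> by (simp add: fibre_form_def)
    next
      case (Some a)
      then show ?thesis using eq q0 by (auto simp: fibre_form_def)
    qed
    ultimately show ?thesis by simp
  next
    assume "q = 0"
    then show ?thesis using assms(1) by (auto simp: is_unit_poly_iff)
  qed
  then show False using assms by simp
qed

lemma degree_fibre_form_le:
  assumes "max (degree p) (degree q) = d"
  shows "degree (fibre_form p q v) \<le> d"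
  using assms
  by (auto simp: fibre_form_def split: option.split
      intro!: degree_diff_le order.trans[OF degree_smult_le])

lemma rat_eval_eq_iff:
  assumes "coprime p q" "max (degree p) (degree q) = d" "d > 0"
  shows "rat_eval p q x = v \<longleftrightarrow> form_eval d (fibre_form p q v) x = 0"
  using coprime_forms_no_common_zero[OF assms, of x]
  unfolding rat_eval_eq_sphere_point[OF assms(2)]
  by (cases v) (auto simp: sphere_point_def fibre_form_def form_eval_diff form_eval_smult field_simps)

lemma fibre_denom_nonzero:
  assumes "coprime p q" "max (degree p) (degree q) = d" "d > 0" "rat_eval p q x = v"
  shows "form_eval d (fibre_denom p q v) x \<noteq> 0"
  using coprime_forms_no_common_zero[OF assms(1-3), of x] assms(4)
  unfolding rat_eval_eq_sphere_point[OF assms(2)]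
  by (auto simp: sphere_point_def fibre_denom_def split: if_splits)

lemma chart_sphere_point:
  assumes "poly (fibre_denom p q v) z \<noteq> 0"
  shows "chart v (sphere_point (poly p z) (poly q z))
     = poly (fibre_form p q v) z / poly (fibre_denom p q v) z"
  using assms
  by (cases v) (auto simp: sphere_point_def fibre_form_def fibre_denom_def field_simps)

lemma zorder_poly_quotient:
  assumes "poly H 0 \<noteq> 0" "poly G 0 \<noteq> 0"
    and "\<And>u. u \<noteq> 0 \<Longrightarrow> poly G u \<noteq> 0 \<Longrightarrow> f u = u ^ n * poly H u / poly G u"
  shows "zorder f (0::complex) = int n"
proof (rule zorder_eqI)
  have "open (poly G -` (- {0}))"
    by (intro open_vimage continuous_on_poly continuous_on_id) auto
  then show "open {u. poly G u \<noteq> 0}" by (simp add: vimage_def)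
  show "(\<lambda>u. poly H u / poly G u) holomorphic_on {u. poly G u \<noteq> 0}"
    by (intro holomorphic_intros) auto
qed (use assms in auto)

text \<open>
  In the chart at \<open>v\<close> the map is the quotient of the fibre form by a form that does not vanish at \<open>x\<close>,
  so its order is that of the fibre form.  At infinity the polynomials are reversed to express them in
  the coordinate \<open>1/z\<close>; reversing a fibre form of degree less than \<open>d\<close> splits off a power of that
  coordinate, and its exponent is the order of vanishing there.
\<close>

lemma local_degree_rat_eval:
  assumes "coprime p q" "max (degree p) (degree q) = d" "d > 0" "rat_eval p q x = v"
  shows "local_degree (rat_eval p q) x = form_order d (fibre_form p q v) x"
proof -
  define N D where "N = fibre_form p q v" and "D = fibre_denom p q v"
  have N0: "N \<noteq> 0" unfolding N_def by (rule fibre_form_nonzero[OF assms(1-3)])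
  have Ndeg: "degree N \<le> d" unfolding N_def by (rule degree_fibre_form_le[OF assms(2)])
  have Dx: "form_eval d D x \<noteq> 0" unfolding D_def by (rule fibre_denom_nonzero[OF assms])
  have Ddeg: "degree D \<le> d"
    using assms(2) by (auto simp: D_def fibre_denom_def split: option.split)
  have quot: "chart v (rat_eval p q (Some z)) = poly N z / poly D z" if "poly D z \<noteq> 0" for z
    using chart_sphere_point that by (simp add: rat_eval_Some N_def D_def)
  have "zorder (\<lambda>u. chart v (rat_eval p q (chart_inv x u))) 0 = int (form_order d N x)"
  proof (cases x)
    case (Some z)
    obtain R where R: "N = [:- z, 1:] ^ order z N * R" "\<not> [:- z, 1:] dvd R"
      using order_decomp[OF N0] by blast
    show ?thesis
    proof (rule zorder_poly_quotient)
      show "poly (pcompose R [:z, 1:]) 0 \<noteq> 0"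
        using R(2) by (simp add: poly_pcompose poly_eq_0_iff_dvd)
      show "poly (pcompose D [:z, 1:]) 0 \<noteq> 0"
        using Dx by (simp add: poly_pcompose Some form_eval_def)
      fix u assume "poly (pcompose D [:z, 1:]) u \<noteq> 0"
      then have "poly D (z + u) \<noteq> 0" by (simp add: poly_pcompose)
      moreover have "poly N (z + u) = u ^ order z N * poly R (z + u)"
        by (subst R(1)) simp
      ultimately show "chart v (rat_eval p q (chart_inv x u))
          = u ^ form_order d N x * poly (pcompose R [:z, 1:]) u / poly (pcompose D [:z, 1:]) u"
        by (simp add: Some quot form_order_def poly_pcompose)
    qed
  next
    case None
    \<comment> \<open>The denominator does not vanish at infinity, so reversing it loses no power of \<open>u\<close>.\<close>
    have Dd: "degree D = d"
      using Dx Ddeg by (auto simp: None form_eval_def intro: antisym le_degree)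
    show ?thesis
    proof (rule zorder_poly_quotient)
      show "poly (reflect_poly N) 0 \<noteq> 0" using N0 by (simp add: poly_0_coeff_0)
      show "poly (reflect_poly D) 0 \<noteq> 0"
        using Dx Dd by (simp add: poly_0_coeff_0 None form_eval_def)
      fix u :: complex assume u: "u \<noteq> 0" "poly (reflect_poly D) u \<noteq> 0"
      then have D: "poly (reflect_poly D) u = u ^ d * poly D (inverse u)"
        by (simp add: poly_reflect_poly_nz Dd)
      with u have "poly D (inverse u) \<noteq> 0" by auto
      moreover have "u ^ (d - degree N) * poly (reflect_poly N) u = u ^ d * poly N (inverse u)"
        using u Ndeg by (simp add: poly_reflect_poly_nz mult.assoc flip: power_add)
      ultimately show "chart v (rat_eval p q (chart_inv x u))
          = u ^ form_order d N x * poly (reflect_poly N) u / poly (reflect_poly D) u"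
        using u by (simp add: None quot D form_order_def)
    qed
  qed
  then show ?thesis by (simp add: local_degree_def assms(4) N_def)
qed

lemma fibre_partition_rat_eval:
  assumes "coprime p q" "max (degree p) (degree q) = d" "d > 0"
  shows "fibre_partition (rat_eval p q) v
     = image_mset (form_order d (fibre_form p q v))
         (mset_set {x. form_eval d (fibre_form p q v) x = 0})"
  using finite_form_zeros[OF fibre_form_nonzero[OF assms]]
  by (auto simp: fibre_partition_def rat_eval_eq_iff[OF assms]
      intro!: image_mset_cong local_degree_rat_eval[OF assms])

text \<open>
  The coefficient vectors \<open>(1, -a)\<close> and \<open>(0, 1)\<close> of the fibre forms with respect to \<open>p\<close> and \<open>q\<close> are
  pairwise independent in a plane, so any third form is a combination of two others with both
  coefficients nonzero.  The minus sign prepares the factorization of a difference of cubes.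
\<close>

lemma fibre_form_pencil:
  assumes "a \<noteq> b" "a \<noteq> c" "b \<noteq> c"
  obtains s t where "s \<noteq> 0" "t \<noteq> 0"
    "fibre_form p q c = smult s (fibre_form p q a) - smult t (fibre_form p q b)"
proof -
  have "\<exists>s t. s \<noteq> 0 \<and> t \<noteq> 0 \<and>
      fibre_form p q c = smult s (fibre_form p q a) - smult t (fibre_form p q b)"
  proof (cases a)
    case None
    then obtain b' c' where bc: "b = Some b'" "c = Some c'" using assms by (cases b; cases c) auto
    then show ?thesis using assms None
      by (intro exI[of _ "b' - c'"] exI[of _ "-1"])
         (auto simp: fibre_form_def smult_diff_left)
  next
    case a: (Some a')
    show ?thesis
    proof (cases b)
      case None
      then obtain c' where "c = Some c'" using assms by (cases c) auto
      then show ?thesis using assms None a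
        by (intro exI[of _ 1] exI[of _ "c' - a'"])
           (auto simp: fibre_form_def smult_diff_left)
    next
      case b: (Some b')
      then have ab: "b' - a' \<noteq> 0" using assms a by auto
      show ?thesis
      proof (cases c)
        case None
        have "p - smult a' q - (p - smult b' q) = smult (b' - a') q"
          by (simp add: smult_diff_left)
        then have "q = smult (1 / (b' - a')) (p - smult a' q)
            - smult (1 / (b' - a')) (p - smult b' q)"
          using ab by (simp flip: smult_diff_right)
        then show ?thesis using ab
          by (intro exI[of _ "1 / (b' - a')"]) (simp add: fibre_form_def a b None)
      next
        case (Some c')
        have "P - c' * Q = (b' - c') / (b' - a') * (P - a' * Q)
            - (a' - c') / (b' - a') * (P - b' * Q)" for P Q
        proof -
          have "(P - c' * Q) * (b' - a') = (b' - c') * (P - a' * Q) - (a' - c') * (P - b' * Q)"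
            by algebra
          then have "P - c' * Q = ((b' - c') * (P - a' * Q) - (a' - c') * (P - b' * Q)) / (b' - a')"
            by (rule iffD2[OF nonzero_eq_divide_eq[OF ab]])
          then show ?thesis unfolding times_divide_eq_left diff_divide_distrib [symmetric] .
        qed
        then show ?thesis using ab assms a b Some
          by (intro exI[of _ "(b' - c') / (b' - a')"] exI[of _ "(a' - c') / (b' - a')"])
             (simp add: fibre_form_def poly_eq_iff)
      qed
    qed
  qed
  then show thesis using that by blast
qed

section \<open>Counting odd local degrees\<close>

lemma primitive_cube_root:
  obtains w :: complex where "w\<^sup>2 + w + 1 = 0"
proof
  show "(Complex (- 1 / 2) (sqrt 3 / 2))\<^sup>2 + Complex (- 1 / 2) (sqrt 3 / 2) + 1 = 0"
    by (simp add: complex_eq_iff power2_eq_square)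
qed

lemma cube_diff_factorization:
  fixes U V :: "complex poly"
  assumes "w\<^sup>2 + w + 1 = 0"
  shows "U ^ 3 - V ^ 3 = (U - smult 1 V) * ((U - smult w V) * (U - smult (w\<^sup>2) V))"
proof -
  have "u ^ 3 - v ^ 3 = (u - v) * ((u - w * v) * (u - w\<^sup>2 * v))" for u v :: complex
    using assms by algebra
  then have "poly (U ^ 3 - V ^ 3) z
      = poly ((U - smult 1 V) * ((U - smult w V) * (U - smult (w\<^sup>2) V))) z" for z
    by simp
  then show ?thesis by (simp add: poly_eq_poly_eq_iff [symmetric] fun_eq_iff)
qed

lemma form_eval_power:
  assumes "degree U \<le> k" "m > 0"
  shows "form_eval (m * k) (U ^ m) x = form_eval k U x ^ m"
proof (cases x)
  case None
  show ?thesis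
  proof (cases "degree U = k")
    case True
    then have "coeff (U ^ m) (m * k) = lead_coeff U ^ m"
      by (cases "U = 0") (use assms in \<open>auto simp: lead_coeff_power power_0_left simp flip: degree_power_eq\<close>)
    then show ?thesis using True by (simp add: None form_eval_def)
  next
    case False
    have "degree (U ^ m) \<le> m * degree U" using degree_power_le[of U m] by (simp add: mult.commute)
    also have "\<dots> < m * k" using False assms by simp
    finally show ?thesis using False assms by (simp add: None form_eval_def coeff_eq_0)
  qed
qed (simp add: form_eval_def)

text \<open>
  At a common zero of two of the factors \<open>U - c V\<close> both \<open>U\<close> and \<open>V\<close> would vanish.  Hence a zero of odd
  order of one factor has the same odd order for the product, and the three factors supply three
  different points.
\<close>

lemma three_odd_orders:
  assumes C0: "U ^ 3 - V ^ 3 \<noteq> 0" and deg: "degree U \<le> k" "degree V \<le> k" and "odd k"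
    and no_common: "\<And>x. form_eval k U x \<noteq> 0 \<or> form_eval k V x \<noteq> 0"
  shows "card {x. odd (form_order (3 * k) (U ^ 3 - V ^ 3) x)} \<ge> 3"
proof -
  obtain w :: complex where w: "w\<^sup>2 + w + 1 = 0" by (rule primitive_cube_root)
  have w1: "w \<noteq> 1" using w by auto
  have w2: "w\<^sup>2 \<noteq> 1"
  proof
    assume sq: "w\<^sup>2 = 1"
    with w have "w + 2 = 0" by (simp add: algebra_simps)
    then have "w = -2" by (simp only: eq_neg_iff_add_eq_0)
    with sq show False by simp
  qed
  have "w * (w - 1) \<noteq> 0" using w w1 by auto
  then have w3: "w \<noteq> w\<^sup>2" by (simp add: power2_eq_square algebra_simps)
  note dist = w1[symmetric] w2[symmetric] w3
  define F where "F c = U - smult c V" for c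
  define n where "n c x = form_order k (F c) x" for c x
  have fact: "U ^ 3 - V ^ 3 = F 1 * (F w * F (w\<^sup>2))"
    unfolding F_def by (rule cube_diff_factorization[OF w])
  define R where "R = {1, w, w\<^sup>2}"
  have R: "1 \<in> R" "w \<in> R" "w\<^sup>2 \<in> R" by (simp_all add: R_def)
  have F0: "F c \<noteq> 0" if "c \<in> R" for c using C0 that by (auto simp: fact R_def)
  have Fdeg: "degree (F c) \<le> k" for c
    unfolding F_def using deg by (intro degree_diff_le order.trans[OF degree_smult_le]) auto
  have three_k: "3 * k = k + (k + k)" by simp
  have "form_order (k + (k + k)) (F 1 * (F w * F (w\<^sup>2))) x = n 1 x + (n w x + n (w\<^sup>2) x)" for x
  proof -
    have nz: "F w * F (w\<^sup>2) \<noteq> 0" "F 1 * (F w * F (w\<^sup>2)) \<noteq> 0"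
      using R F0 by auto
    have deg2: "degree (F w * F (w\<^sup>2)) \<le> k + k"
      using Fdeg[of w] Fdeg[of "w\<^sup>2"] by (intro order.trans[OF degree_mult_le] add_mono)
    show ?thesis
      unfolding n_def form_order_mult[OF nz(2) Fdeg deg2] form_order_mult[OF nz(1) Fdeg Fdeg] ..
  qed
  then have sum: "form_order (3 * k) (U ^ 3 - V ^ 3) x = n 1 x + (n w x + n (w\<^sup>2) x)" for x
    unfolding fact three_k .
  have disjoint: "n c' x = 0" if "odd (n c x)" "c \<in> R" "c' \<in> R" "c \<noteq> c'" for c c' x
  proof (rule ccontr)
    assume "n c' x \<noteq> 0"
    moreover have "n c x \<noteq> 0" using that(1) by (metis even_zero)
    ultimately have "form_eval k (F c) x = 0" "form_eval k (F c') x = 0"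
      using form_order_pos_iff[OF F0 Fdeg] that(2,3) unfolding n_def by blast+
    then have "form_eval k U x = c * form_eval k V x" "form_eval k U x = c' * form_eval k V x"
      by (simp_all add: F_def form_eval_diff form_eval_smult)
    then show False using no_common[of x] that(4) by auto
  qed
  have "\<exists>x. odd (n c x)" if "c \<in> R" for c
    using odd_form_has_odd_order_zero[OF F0[OF that] Fdeg \<open>odd k\<close>] unfolding n_def by blast
  then obtain x1 x2 x3 where x: "odd (n 1 x1)" "odd (n w x2)" "odd (n (w\<^sup>2) x3)" using R by metis
  have others: "n w x1 = 0" "n (w\<^sup>2) x1 = 0" "n 1 x2 = 0" "n (w\<^sup>2) x2 = 0"
      "n 1 x3 = 0" "n w x3 = 0"
    using disjoint[OF x(1) R(1) R(2) dist(1)] disjoint[OF x(1) R(1) R(3) dist(2)]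
      disjoint[OF x(2) R(2) R(1) dist(1)[symmetric]] disjoint[OF x(2) R(2) R(3) dist(3)]
      disjoint[OF x(3) R(3) R(1) dist(2)[symmetric]] disjoint[OF x(3) R(3) R(2) dist(3)[symmetric]]
    by this+
  have "{x1, x2, x3} \<subseteq> {x. odd (form_order (3 * k) (U ^ 3 - V ^ 3) x)}"
    using x by (simp add: sum others)
  moreover have "finite {x. odd (form_order (3 * k) (U ^ 3 - V ^ 3) x)}"
  proof (rule finite_subset)
    have "degree (U ^ 3 - V ^ 3) \<le> 3 * k"
      using deg degree_power_le[of U 3] degree_power_le[of V 3] by (intro degree_diff_le) auto
    then show "{x. odd (form_order (3 * k) (U ^ 3 - V ^ 3) x)}
        \<subseteq> {x. form_eval (3 * k) (U ^ 3 - V ^ 3) x = 0}"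
      using form_order_pos_iff[OF C0] odd_pos by blast
  qed (rule finite_form_zeros[OF C0])
  moreover have "x1 \<noteq> x2" "x1 \<noteq> x3" "x2 \<noteq> x3"
    using x others by (metis even_zero)+
  then have "card {x1, x2, x3} = 3" by simp
  ultimately show ?thesis by (metis card_mono)
qed

text \<open>
  This turns the three entries of a branching datum into three distinct branching points, even
  though two of the entries coincide as partitions.
\<close>

lemma image_mset_set_eq_triple:
  assumes "image_mset f (mset_set S) = {#x, y, z#}"
  obtains a b c where "a \<noteq> b" "a \<noteq> c" "b \<noteq> c" "f a = x" "f b = y" "f c = z"
proof -
  obtain a M where a: "mset_set S = add_mset a M" "f a = x" "image_mset f M = {#y, z#}"
    using msed_map_invR[OF assms] by blast
  obtain b M' where b: "M = add_mset b M'" "f b = y" "image_mset f M' = {#z#}"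
    using msed_map_invR[OF a(3)] by blast
  obtain c M'' where c: "M' = add_mset c M''" "f c = z" "image_mset f M'' = {#}"
    using msed_map_invR[OF b(3)] by blast
  have S: "mset_set S = {#a, b, c#}" using a b c by simp
  have "count (mset_set S) u \<le> 1" for u
    by (cases "finite S"; cases "u \<in> S") auto
  from this[of a] this[of b] have "a \<noteq> b" "a \<noteq> c" "b \<noteq> c"
    by (auto simp: S split: if_splits)
  then show thesis using that a b c by blast
qed

text \<open>
  All local degrees in the fibre are \<open>3\<close>, so the fibre form is a cube up to the constant \<open>s\<close>, and over
  \<open>\<complex>\<close> the constant is absorbed in the cube root.  The last conclusion says that zeros of the root
  lie in the fibre, at infinity as well; for fibres over different points it excludes common
  zeros.
\<close>

lemma fibre_form_is_cube:
  assumes "coprime p q" "max (degree p) (degree q) = 3 * k" "k > 0" "s \<noteq> 0"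
    and "fibre_partition (rat_eval p q) v = replicate_mset r 3"
  obtains U where "smult s (fibre_form p q v) = U ^ 3" "degree U \<le> k"
    "\<And>x. form_eval k U x = 0 \<Longrightarrow> rat_eval p q x = v"
proof -
  define A where "A = fibre_form p q v"
  have d: "3 * k > 0" using assms(3) by simp
  have A0: "A \<noteq> 0" unfolding A_def by (rule fibre_form_nonzero[OF assms(1,2) d])
  have Adeg: "degree A \<le> 3 * k" unfolding A_def by (rule degree_fibre_form_le[OF assms(2)])
  have "3 dvd order z (smult s A)" for z
  proof (cases "poly A z = 0")
    case True
    then have "form_order (3 * k) A (Some z) \<in># fibre_partition (rat_eval p q) v"
      using finite_form_zeros[OF A0]
      by (auto simp: fibre_partition_rat_eval[OF assms(1,2) d] A_def form_eval_def)
    then show ?thesis by (simp add: assms(4,5) form_order_def order_smult split: if_splits)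
  next
    case False
    then show ?thesis by (simp add: order_smult assms(4) order_0I)
  qed
  then obtain U where U: "smult s A = U ^ 3" using complex_poly_is_power[of 3 "smult s A"] by auto
  then have "U \<noteq> 0" using A0 assms(4) by auto
  have "degree (U ^ 3) \<le> 3 * k" using Adeg by (simp flip: U add: assms(4))
  then have Udeg: "degree U \<le> k" using \<open>U \<noteq> 0\<close> by (simp add: degree_power_eq)
  have "rat_eval p q x = v" if "form_eval k U x = 0" for x
  proof -
    have "s * form_eval (3 * k) A x = 0"
      using form_eval_power[OF Udeg, of 3 x] that by (simp flip: form_eval_smult add: U)
    then show ?thesis using assms(4) by (simp add: rat_eval_eq_iff[OF assms(1,2) d] A_def)
  qed
  with U Udeg show thesis using that by (simp add: A_def)
qed

theorem proposition1p4:
  fixes d k j1 j2 :: nat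
  assumes "d = 3 * k" and "k \<ge> 3" and "k mod 2 = 1"
    and "j1 > 0" and "j2 > 0"
    and "candidate_branching_datum d
           {# {#j1, j2#} + replicate_mset k 2, replicate_mset k 3, replicate_mset k 3 #}"
    and "even j1 \<noteq> even j2"
  shows "exceptional d
           {# {#j1, j2#} + replicate_mset k 2, replicate_mset k 3, replicate_mset k 3 #}"
  unfolding exceptional_def
proof (intro conjI notI)
  assume "\<exists>h. rational_map_of_degree d h \<and> branching_datum d h =
      {# {#j1, j2#} + replicate_mset k 2, replicate_mset k 3, replicate_mset k 3 #}"
  then obtain p q where pq: "coprime p q" "max (degree p) (degree q) = 3 * k"
    and datum: "branching_datum d (rat_eval p q) =
      {# {#j1, j2#} + replicate_mset k 2, replicate_mset k 3, replicate_mset k 3 #}"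
    using assms(1) by (auto simp: rational_map_of_degree_def)
  have k: "odd k" "k > 0" "3 * k > 0" using assms(2,3) by presburger+
  obtain c a b where abc: "c \<noteq> a" "c \<noteq> b" "a \<noteq> b"
    and fib: "fibre_partition (rat_eval p q) c = {#j1, j2#} + replicate_mset k 2"
      "fibre_partition (rat_eval p q) a = replicate_mset k 3"
      "fibre_partition (rat_eval p q) b = replicate_mset k 3"
    using datum unfolding branching_datum_def by (rule image_mset_set_eq_triple)
  obtain s t where st: "s \<noteq> 0" "t \<noteq> 0"
    and pencil: "fibre_form p q c = smult s (fibre_form p q a) - smult t (fibre_form p q b)"
    using fibre_form_pencil abc by metis
  obtain U where U: "smult s (fibre_form p q a) = U ^ 3" "degree U \<le> k"
      "\<And>x. form_eval k U x = 0 \<Longrightarrow> rat_eval p q x = a"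
    using fibre_form_is_cube[OF pq k(2) st(1) fib(2)] by blast
  obtain V where V: "smult t (fibre_form p q b) = V ^ 3" "degree V \<le> k"
      "\<And>x. form_eval k V x = 0 \<Longrightarrow> rat_eval p q x = b"
    using fibre_form_is_cube[OF pq k(2) st(2) fib(3)] by blast
  define C where "C = fibre_form p q c"
  have C: "C = U ^ 3 - V ^ 3" by (simp add: C_def pencil U(1) V(1))
  have C0: "C \<noteq> 0" unfolding C_def by (rule fibre_form_nonzero[OF pq k(3)])
  have Cdeg: "degree C \<le> 3 * k" unfolding C_def by (rule degree_fibre_form_le[OF pq(2)])
  have "3 \<le> card {x. odd (form_order (3 * k) C x)}"
    unfolding C
  proof (rule three_odd_orders)
    show "form_eval k U x \<noteq> 0 \<or> form_eval k V x \<noteq> 0" for x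
      using U(3) V(3) abc(3) by metis
  qed (use C0[unfolded C] U(2) V(2) k(1) in simp_all)
  also have "{x. odd (form_order (3 * k) C x)}
      = {x \<in> {x. form_eval (3 * k) C x = 0}. odd (form_order (3 * k) C x)}"
    using form_order_pos_iff[OF C0 Cdeg] odd_pos by blast
  also have "card \<dots> = size (filter_mset odd (fibre_partition (rat_eval p q) c))"
    using finite_form_zeros[OF C0]
    by (simp add: fibre_partition_rat_eval[OF pq k(3)] filter_mset_image_mset C_def)
  also have "\<dots> \<le> 2"
  proof -
    have "filter_mset odd (replicate_mset k (2 :: nat)) = {#}" by (induction k) auto
    note no_odd_twos = this
    show ?thesis by (simp add: fib(1) no_odd_twos)
  qed
  finally show False by simp
qed (rule assms(6))

end
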